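(* Let $f,\bar f, g$ and $P_g^{\tilde g}$ be as in the context, so that $\mathcal{F}f=g$ and $\mathcal{F}\bar f=P_g^{\tilde g}$, where $P_g^{\tilde g}$ is the (extended) variably scaled kernel interpolant of the samples of $g$ at points of the compact set $D\subset\mathbb{R}^d$. Assume that the continuous functions $f,\bar f,g$ and $P_g^{\tilde g}$ belong to $L_2(\mathbb{R}^d)$. Then $$\|f-\bar f\|_{L_2(\mathbb{R}^d)}\le \nu+\|g-P_g^{\tilde g}\|_{L_2(\mathbb{R}^d\setminus D)},$$ where $$\nu=\sup_{\boldsymbol{u}\in\mathbb{R}^d}\Big(\big(g(\boldsymbol{u})-P_g^{\tilde g}(\boldsymbol{u})\big)^2\,\mu(D)\Big)^{1/2}.$$
   Context: $\mathcal{F}:L^2(\mathbb{R}^d)\to L^2(\mathbb{R}^d)$ is the Fourier operator, normalized to be unitary (given by $(\mathcal{F}f)(\boldsymbol{u})=\int f(\boldsymbol{x})e^{2\pi \imath \boldsymbol{x}\cdot\boldsymbol{u}}\,d\boldsymbol{x}$ on integrable functions). $\mu$ is Lebesgue measure on $\mathbb{R}^d$. The functions $f,g$ are continuous and real-valued with $\mathcal{F}f=g$. Variably scaled kernel (VSK) interpolant: $D\subset\mathbb{R}^d$ is compact, $\boldsymbol{u}_1,\dots,\boldsymbol{u}_n\in D$ are distinct points, $g_i=g(\boldsymbol{u}_i)$, $\tilde g:D\to\mathbb{R}$ is a given function (the scaling function), extended by zero to $\mathbb{R}^d$, and $\kappa$ is a strictly positive definite radial kernel on $\mathbb{R}^{d+1}$.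 On $D$ put $$P_g^{\tilde g}(\boldsymbol{u})=\sum_{i=1}^n c_i\,\kappa\big((\boldsymbol{u}_i,\tilde g(\boldsymbol{u}_i)),(\boldsymbol{u},\tilde g(\boldsymbol{u}))\big),$$ where $\boldsymbol{c}=(c_1,\dots,c_n)^{\intercal}$ solves $\mathsf{K}\boldsymbol{c}=(g_1,\dots,g_n)^{\intercal}$, $\mathsf{K}_{ij}=\kappa((\boldsymbol{u}_i,\tilde g(\boldsymbol{u}_i)),(\boldsymbol{u}_j,\tilde g(\boldsymbol{u}_j)))$. Extension to $\mathbb{R}^d$: fix $c>0$, let $\hat P_g^{\tilde g}=P_g^{\tilde g}$ on $D$ and $\hat P_g^{\tilde g}=c$ outside $D$, and set $P_g^{\tilde g}=\hat P_g^{\tilde g}\cdot\phi$ on $\mathbb{R}^d$, where $\phi=1$ on $D$, $\phi=\phi_1$ on $\mathbb{R}^d\setminus D$, $\phi_1$ is smooth and rapidly decreasing to $0$, and $\phi$ is continuous on $\mathbb{R}^d$. The function $\bar f$ is defined by $\mathcal{F}\bar f=P_g^{\tilde g}$. *)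

theory Defs
  imports "HOL-Analysis.Analysis"
begin

text \<open>
  \<open>\<real>\<^sup>d\<close> is an arbitrary \<open>'a :: euclidean_space\<close> and \<open>\<real>\<^sup>d\<^sup>+\<^sup>1\<close> is \<open>'a \<times> real\<close>, whose library norm is
  the Euclidean one.
\<close>

section \<open>Square-integrable functions and the Fourier operator\<close>

definition square_integrable ::
    "('a::euclidean_space \<Rightarrow> 'b::{real_normed_vector, second_countable_topology}) \<Rightarrow> bool" where
  "square_integrable f \<longleftrightarrow>
     f \<in> borel_measurable lebesgue \<and> integrable lebesgue (\<lambda>x. (norm (f x))\<^sup>2)"

text \<open>Meaningful for functions that are square-integrable on \<open>S\<close>; the Bochner integral defaults to 0
  otherwise.\<close>

definition L2_norm_on ::
    "'a::euclidean_space set \<Rightarrow> ('a \<Rightarrow> 'b::real_normed_vector) \<Rightarrow> real" where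
  "L2_norm_on S f = sqrt (LINT x:S|lebesgue. (norm (f x))\<^sup>2)"

definition fourier_integral :: "('a::euclidean_space \<Rightarrow> complex) \<Rightarrow> 'a \<Rightarrow> complex" where
  "fourier_integral f u =
     (LINT x|lebesgue. f x * exp (2 * complex_of_real pi * \<i> * complex_of_real (x \<bullet> u)))"

text \<open>
  Graph of the unitary Fourier operator \<open>L\<^sup>2 \<rightarrow> L\<^sup>2\<close>, i.e. of the extension by continuity of
  the integral transform from the dense subspace \<open>L\<^sup>1 \<inter> L\<^sup>2\<close>. It respects equality almost
  everywhere in both arguments. Square-integrability of the transforms \<open>fourier_integral (h k)\<close>
  is automatic (Plancherel); it is listed so that the second \<open>L2_norm_on\<close> is visibly a genuine
  norm.
\<close>

definition is_fourier_L2 ::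
    "('a::euclidean_space \<Rightarrow> complex) \<Rightarrow> ('a \<Rightarrow> complex) \<Rightarrow> bool" where
  "is_fourier_L2 f g \<longleftrightarrow>
     square_integrable f \<and> square_integrable g \<and>
     (\<exists>h :: nat \<Rightarrow> 'a \<Rightarrow> complex.
        (\<forall>k. integrable lebesgue (h k) \<and> square_integrable (h k) \<and>
             square_integrable (fourier_integral (h k))) \<and>
        (\<lambda>k. L2_norm_on UNIV (\<lambda>x. h k x - f x)) \<longlonglongrightarrow> 0 \<and>
        (\<lambda>k. L2_norm_on UNIV (\<lambda>u. fourier_integral (h k) u - g u)) \<longlonglongrightarrow> 0)"

section \<open>Kernels\<close>

definition radial_kernel :: "('b::real_normed_vector \<Rightarrow> 'b \<Rightarrow> real) \<Rightarrow> bool" where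
  "radial_kernel \<kappa> \<longleftrightarrow> (\<exists>\<Phi> :: real \<Rightarrow> real. \<forall>x y. \<kappa> x y = \<Phi> (norm (x - y)))"

definition strictly_positive_definite :: "('b \<Rightarrow> 'b \<Rightarrow> real) \<Rightarrow> bool" where
  "strictly_positive_definite \<kappa> \<longleftrightarrow>
     (\<forall>(X :: 'b set) (a :: 'b \<Rightarrow> real). finite X \<longrightarrow> (\<exists>x\<in>X. a x \<noteq> 0) \<longrightarrow>
        (\<Sum>x\<in>X. \<Sum>y\<in>X. a x * a y * \<kappa> x y) > 0)"

section \<open>Variably scaled kernel interpolation\<close>

text \<open>The nodes are \<open>p 1, \<dots>, p n\<close> and \<open>s\<close> is the scaling function.\<close>

definition vsk_matrix ::
    "('a \<times> real \<Rightarrow> 'a \<times> real \<Rightarrow> real) \<Rightarrow> ('a \<Rightarrow> real) \<Rightarrow> (nat \<Rightarrow> 'a) \<Rightarrow> nat \<Rightarrow> nat \<Rightarrow> real" where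
  "vsk_matrix \<kappa> s p i j = \<kappa> (p i, s (p i)) (p j, s (p j))"

definition vsk_interpolant ::
    "('a \<times> real \<Rightarrow> 'a \<times> real \<Rightarrow> real) \<Rightarrow> ('a \<Rightarrow> real) \<Rightarrow> nat \<Rightarrow> (nat \<Rightarrow> 'a) \<Rightarrow> (nat \<Rightarrow> real) \<Rightarrow>
       'a \<Rightarrow> real" where
  "vsk_interpolant \<kappa> s n p a u = (\<Sum>i=1..n. a i * \<kappa> (p i, s (p i)) (u, s u))"

section \<open>Extension to the whole space\<close>

text \<open>\<open>C_k_on k f S\<close>: \<open>f\<close> is of class \<open>C\<^sup>k\<close> on \<open>S\<close>, for open \<open>S\<close>.\<close>

primrec C_k_on :: "nat \<Rightarrow> ('a::euclidean_space \<Rightarrow> real) \<Rightarrow> 'a set \<Rightarrow> bool" where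
  "C_k_on 0 f S \<longleftrightarrow> continuous_on S f"
| "C_k_on (Suc k) f S \<longleftrightarrow>
     (\<forall>x\<in>S. f differentiable (at x)) \<and>
     (\<forall>v. C_k_on k (\<lambda>x. frechet_derivative f (at x) v) S)"

definition smooth_on :: "('a::euclidean_space \<Rightarrow> real) \<Rightarrow> 'a set \<Rightarrow> bool" where
  "smooth_on f S \<longleftrightarrow> (\<forall>k. C_k_on k f S)"

definition rapidly_decreasing :: "('a::euclidean_space \<Rightarrow> real) \<Rightarrow> bool" where
  "rapidly_decreasing f \<longleftrightarrow> (\<forall>k::nat. ((\<lambda>x. norm x ^ k * f x) \<longlongrightarrow> 0) at_infinity)"

definition cutoff :: "'a set \<Rightarrow> ('a \<Rightarrow> real) \<Rightarrow> 'a \<Rightarrow> real" where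
  "cutoff D \<phi>1 u = (if u \<in> D then 1 else \<phi>1 u)"

definition extend_interpolant ::
    "'a set \<Rightarrow> real \<Rightarrow> ('a \<Rightarrow> real) \<Rightarrow> ('a \<Rightarrow> real) \<Rightarrow> 'a \<Rightarrow> real" where
  "extend_interpolant D c \<phi>1 I u = (if u \<in> D then I u else c) * cutoff D \<phi>1 u"

end

theory Submission
  imports Defs "HOL-Probability.Probability"
begin

text \<open>
  The only analytic input is the Plancherel inequality \<open>\<parallel>h\<parallel> \<le> \<parallel>F h\<parallel>\<close> for \<open>h\<close> in \<open>L\<^sup>1 \<inter> L\<^sup>2\<close>. Damping
  the transform by the self-dual Gaussian \<open>\<gamma> x = exp (- \<pi> |x|\<^sup>2)\<close> and using Fubini,
  \<open>\<integral> \<gamma> (t u) |F h u|\<^sup>2 du = \<integral> \<gamma> z A (t z) dz\<close> with \<open>A w = \<integral> h x cnj (h (x - w)) dx\<close>. The left side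
  is at most \<open>\<parallel>F h\<parallel>\<^sup>2\<close>; as \<open>t \<rightarrow> 0\<close> the right side tends to \<open>A 0 = \<parallel>h\<parallel>\<^sup>2\<close>, because
  \<open>Re (A w) = \<parallel>h\<parallel>\<^sup>2 - \<integral> |h x - h (x - w)|\<^sup>2 dx / 2\<close> and translation is continuous in \<open>L\<^sup>2\<close>.
  By density the inequality passes to the \<open>L\<^sup>2\<close> Fourier operator, so \<open>\<parallel>f - fbar\<parallel> \<le> \<parallel>g - P\<parallel>\<close>; it remains
  to split the last norm along \<open>D\<close> and its complement.
\<close>

section \<open>Translations in \<open>L\<^sup>1\<close>\<close>

lemma integral_lborel_translate:
  fixes f :: "'a::euclidean_space \<Rightarrow> 'b::{banach, second_countable_topology}"
  assumes [measurable]: "f \<in> borel_measurable borel"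
  shows "(LINT x|lborel. f (x - w)) = (LINT x|lborel. f x)"
    and "integrable lborel (\<lambda>x. f (x - w)) \<longleftrightarrow> integrable lborel f"
proof -
  have eq: "lborel = distr lborel borel (\<lambda>x::'a. x - w)"
  proof -
    have "(+) (- w) = (\<lambda>x. x - w)" by auto
    then show ?thesis using lborel_distr_plus[of "- w"] by simp
  qed
  show "(LINT x|lborel. f (x - w)) = (LINT x|lborel. f x)"
    by (subst (2) eq) (simp add: integral_distr)
  show "integrable lborel (\<lambda>x. f (x - w)) \<longleftrightarrow> integrable lborel f"
    by (subst (2) eq) (simp add: integrable_distr_eq)
qed

lemma integral_lborel_scale:
  fixes f :: "'a::euclidean_space \<Rightarrow> 'b::{banach, second_countable_topology}"
  assumes [measurable]: "f \<in> borel_measurable borel" and t: "t > 0"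
  shows "(LINT x|lborel. f x) = t ^ DIM('a) *\<^sub>R (LINT x|lborel. f (t *\<^sub>R x))"
    and "integrable lborel (\<lambda>x. f (t *\<^sub>R x)) \<longleftrightarrow> integrable lborel f"
proof -
  have eq: "lborel = density (distr lborel borel (\<lambda>x::'a. t *\<^sub>R x)) (\<lambda>_. ennreal (t ^ DIM('a)))"
    using lborel_affine[of t "0::'a"] t by simp
  show "(LINT x|lborel. f x) = t ^ DIM('a) *\<^sub>R (LINT x|lborel. f (t *\<^sub>R x))"
    using t by (subst eq) (simp add: integral_density integral_distr)
  show "integrable lborel (\<lambda>x. f (t *\<^sub>R x)) \<longleftrightarrow> integrable lborel f"
  proof -
    have "integrable lborel (\<lambda>x. t ^ DIM('a) *\<^sub>R f (t *\<^sub>R x)) \<longleftrightarrow> integrable lborel (\<lambda>x. f (t *\<^sub>R x))"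
      using t integrable_scaleR_right[of "1 / t ^ DIM('a)" lborel "\<lambda>x. t ^ DIM('a) *\<^sub>R f (t *\<^sub>R x)"]
      by auto
    then show ?thesis
      using t by (subst (2) eq) (simp add: integrable_density integrable_distr_eq)
  qed
qed

text \<open>Sequences replace the limit over shifts so that dominated convergence applies directly.
  The notion is meaningful for integrable \<open>u\<close>, since otherwise the Bochner integral may
  take its default value 0.\<close>

definition L1_shift_continuous :: "('a::euclidean_space \<Rightarrow> real) \<Rightarrow> bool" where
  "L1_shift_continuous u \<longleftrightarrow>
     (\<forall>w. w \<longlonglongrightarrow> 0 \<longrightarrow> (\<lambda>n. LINT x|lborel. \<bar>u x - u (x - w n)\<bar>) \<longlonglongrightarrow> 0)"

text \<open>An e/3 argument: translation invariance makes the error between \<open>u\<close> and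
  \<open>v\<close> the same before and after a shift, so it is counted twice.\<close>

lemma L1_shift_continuous_closed:
  fixes u :: "'a::euclidean_space \<Rightarrow> real"
  assumes u: "integrable lborel u"
    and approx: "\<And>e. e > 0 \<Longrightarrow>
      \<exists>v. integrable lborel v \<and> L1_shift_continuous v \<and> (LINT x|lborel. \<bar>u x - v x\<bar>) < e"
  shows "L1_shift_continuous u"
  unfolding L1_shift_continuous_def
proof (intro allI impI LIMSEQ_I)
  fix w :: "nat \<Rightarrow> 'a" and e :: real
  assume w: "w \<longlonglongrightarrow> 0" and e: "0 < e"
  then obtain v where v: "integrable lborel v" "L1_shift_continuous v"
    and close: "(LINT x|lborel. \<bar>u x - v x\<bar>) < e / 3"
    using approx[of "e / 3"] by auto
  have [measurable]: "u \<in> borel_measurable borel" "v \<in> borel_measurable borel"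
    using u v by (auto dest: borel_measurable_integrable)
  have shift: "integrable lborel (\<lambda>x. u (x - y))" "integrable lborel (\<lambda>x. v (x - y))" for y
    using u v by (simp_all add: integral_lborel_translate)
  have bound: "(LINT x|lborel. \<bar>u x - u (x - y)\<bar>)
      \<le> (LINT x|lborel. \<bar>v x - v (x - y)\<bar>) + 2 * (LINT x|lborel. \<bar>u x - v x\<bar>)" for y
  proof -
    have "(LINT x|lborel. \<bar>u x - u (x - y)\<bar>)
        \<le> (LINT x|lborel. \<bar>v x - v (x - y)\<bar> + (\<bar>u x - v x\<bar> + \<bar>u (x - y) - v (x - y)\<bar>))"
      by (intro integral_mono Bochner_Integration.integrable_add integrable_abs
          Bochner_Integration.integrable_diff u v shift) linarith
    also have "\<dots> = (LINT x|lborel. \<bar>v x - v (x - y)\<bar>)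
        + ((LINT x|lborel. \<bar>u x - v x\<bar>) + (LINT x|lborel. \<bar>u (x - y) - v (x - y)\<bar>))"
      using u v shift by simp
    also have "(LINT x|lborel. \<bar>u (x - y) - v (x - y)\<bar>) = (LINT x|lborel. \<bar>u x - v x\<bar>)"
      by (rule integral_lborel_translate(1)[where f = "\<lambda>x. \<bar>u x - v x\<bar>"]) measurable
    finally show ?thesis by simp
  qed
  have "(\<lambda>n. LINT x|lborel. \<bar>v x - v (x - w n)\<bar>) \<longlonglongrightarrow> 0"
    using v w by (auto simp: L1_shift_continuous_def)
  then have "\<forall>\<^sub>F n in sequentially. (LINT x|lborel. \<bar>v x - v (x - w n)\<bar>) < e / 3"
    by (rule order_tendstoD) (use e in simp)
  then obtain N where N: "\<And>n. n \<ge> N \<Longrightarrow> (LINT x|lborel. \<bar>v x - v (x - w n)\<bar>) < e / 3"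
    by (auto simp: eventually_sequentially)
  have "norm ((LINT x|lborel. \<bar>u x - u (x - w n)\<bar>) - 0) < e" if "n \<ge> N" for n
    using bound[of "w n"] N[OF that] close by (simp add: Bochner_Integration.integral_nonneg)
  then show "\<exists>N. \<forall>n\<ge>N. norm ((LINT x|lborel. \<bar>u x - u (x - w n)\<bar>) - 0) < e" by blast
qed

lemma L1_shift_continuous_open:
  fixes U :: "'a::euclidean_space set"
  assumes U: "open U" "emeasure lborel U < \<infinity>"
  shows "L1_shift_continuous (indicator U)"
  unfolding L1_shift_continuous_def
proof (intro allI impI)
  fix w :: "nat \<Rightarrow> 'a" assume w: "w \<longlonglongrightarrow> 0"
  have [measurable]: "U \<in> sets borel" using U by simp
  let ?i = "indicator U :: 'a \<Rightarrow> real"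
  have int: "integrable lborel ?i" using U by simp
  have [measurable]: "?i \<in> borel_measurable borel" by simp
  have shift: "integrable lborel (\<lambda>x. ?i (x - y))" for y
    by (subst integral_lborel_translate(2)) (use int in auto)
  txt \<open>Passing to the positive part makes lower semicontinuity of the indicator sufficient, and the
    indicator itself becomes a dominating function.\<close>
  have half: "(LINT x|lborel. \<bar>?i x - ?i (x - y)\<bar>) = 2 * (LINT x|lborel. max 0 (?i x - ?i (x - y)))" for y
  proof -
    \<comment> \<open>Here \<open>\<bar>a\<bar> = 2 * max 0 a - a\<close> is used, and the linear
      term integrates to 0 by translation invariance.\<close>
    have "(LINT x|lborel. \<bar>?i x - ?i (x - y)\<bar>)
        = (LINT x|lborel. 2 * max 0 (?i x - ?i (x - y)) - (?i x - ?i (x - y)))"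
      by (intro Bochner_Integration.integral_cong) (auto simp: max_def)
    also have "\<dots> = 2 * (LINT x|lborel. max 0 (?i x - ?i (x - y)))
        - ((LINT x|lborel. ?i x) - (LINT x|lborel. ?i (x - y)))"
      using int shift by (subst Bochner_Integration.integral_diff) (auto intro!: integrable_max)
    also have "(LINT x|lborel. ?i (x - y)) = (LINT x|lborel. ?i x)"
      by (rule integral_lborel_translate(1)) measurable
    finally show ?thesis by simp
  qed
  have "(\<lambda>n. LINT x|lborel. max 0 (?i x - ?i (x - w n))) \<longlonglongrightarrow> (LINT x::'a|lborel. 0)"
  proof (rule integral_dominated_convergence[where w = ?i])
    show "AE x in lborel. (\<lambda>n. max 0 (?i x - ?i (x - w n))) \<longlonglongrightarrow> 0"
    proof (rule AE_I2)
      fix x :: 'a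
      have lim: "(\<lambda>n. x - w n) \<longlonglongrightarrow> x" using tendsto_diff[OF tendsto_const w] by simp
      have "\<forall>\<^sub>F n in sequentially. max 0 (?i x - ?i (x - w n)) = 0"
      proof (cases "x \<in> U")
        case True
        then have "\<forall>\<^sub>F n in sequentially. x - w n \<in> U"
          using lim U by (auto dest: topological_tendstoD)
        then show ?thesis by eventually_elim (use True in auto)
      qed auto
      then show "(\<lambda>n. max 0 (?i x - ?i (x - w n))) \<longlonglongrightarrow> 0"
        by (rule tendsto_eventually)
    qed
  qed (use int in \<open>auto simp: indicator_def\<close>)
  then show "(\<lambda>n. LINT x|lborel. \<bar>?i x - ?i (x - w n)\<bar>) \<longlonglongrightarrow> 0"
    unfolding half by (intro tendsto_mult_right_zero) simp
qed

text \<open>Induction over integrable functions. Indicators are approximated in L1 by indicators of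
  open sets, sums follow from the triangle inequality, and limits from closedness under L1
  approximation.\<close>

lemma L1_shift_continuous_integrable:
  fixes u :: "'a::euclidean_space \<Rightarrow> real"
  assumes "integrable lborel u"
  shows "L1_shift_continuous u"
  using assms
proof (induction rule: integrable_induct)
  case (base A c)
  let ?i = "\<lambda>S. indicator S :: 'a \<Rightarrow> real"
  have "L1_shift_continuous (?i A)"
  proof (rule L1_shift_continuous_closed)
    show "integrable lborel (?i A)" using base by auto
    fix e :: real assume "e > 0"
    have "A \<in> sets lebesgue" using base by auto
    \<comment> \<open>Outer regularity: the L1 distance between the indicators of \<open>A\<close>
      and \<open>U\<close> is the measure of \<open>U - A\<close>, hence below
      \<open>e\<close>.\<close>
    then obtain U where U: "open U" "A \<subseteq> U" "emeasure lebesgue (U - A) < ennreal e"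
      using sets_lebesgue_outer_open[OF _ \<open>e > 0\<close>] by metis
    have [measurable]: "U \<in> sets borel" "A \<in> sets borel" using U base by auto
    have UA: "emeasure lborel (U - A) < ennreal e" using U by simp
    have "emeasure lborel U \<le> emeasure lborel A + emeasure lborel (U - A)"
      using emeasure_subadditive[of A lborel "U - A"] U(2) by (auto simp: Un_absorb1)
    also have "\<dots> < \<infinity>"
      using base UA by (simp add: order.strict_trans[OF UA])
    finally have fin: "emeasure lborel U < \<infinity>" .
    have "(LINT x|lborel. \<bar>?i A x - ?i U x\<bar>) = (LINT x|lborel. ?i (U - A) x)"
      using U(2) by (intro Bochner_Integration.integral_cong) (auto simp: indicator_def)
    also have "\<dots> = measure lborel (U - A)" by simp
    also have "\<dots> < e"
      using UA \<open>e > 0\<close> by (subst measure_def, subst enn2real_less_iff) (auto intro: order.strict_trans)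
    finally show "\<exists>v. integrable lborel v \<and> L1_shift_continuous v \<and> (LINT x|lborel. \<bar>?i A x - v x\<bar>) < e"
      using fin U(1) by (intro exI[of _ "?i U"]) (auto intro: L1_shift_continuous_open)
  qed
  moreover have "(LINT x|lborel. \<bar>?i A x *\<^sub>R c - ?i A (x - y) *\<^sub>R c\<bar>)
      = \<bar>c\<bar> * (LINT x|lborel. \<bar>?i A x - ?i A (x - y)\<bar>)" for y
    by (simp flip: integral_mult_right_zero abs_mult add: algebra_simps)
  ultimately show ?case
    unfolding L1_shift_continuous_def by (auto intro!: tendsto_mult_right_zero)
next
  case (add u v)
  have [measurable]: "u \<in> borel_measurable borel" "v \<in> borel_measurable borel"
    using add by (auto dest: borel_measurable_integrable)
  have shift: "integrable lborel (\<lambda>x. u (x - y))" "integrable lborel (\<lambda>x. v (x - y))" for y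
    using add by (simp_all add: integral_lborel_translate)
  show ?case
    unfolding L1_shift_continuous_def
  proof (intro allI impI)
    fix w :: "nat \<Rightarrow> 'a" assume "w \<longlonglongrightarrow> 0"
    then have lim: "(\<lambda>n. (LINT x|lborel. \<bar>u x - u (x - w n)\<bar>)
        + (LINT x|lborel. \<bar>v x - v (x - w n)\<bar>)) \<longlonglongrightarrow> 0"
      using add.IH unfolding L1_shift_continuous_def by (auto intro: tendsto_add_zero)
    have "(LINT x|lborel. \<bar>u x + v x - (u (x - y) + v (x - y))\<bar>)
        \<le> (LINT x|lborel. \<bar>u x - u (x - y)\<bar>) + (LINT x|lborel. \<bar>v x - v (x - y)\<bar>)" for y
      by (subst Bochner_Integration.integral_add[symmetric];
          (intro integral_mono Bochner_Integration.integrable_add integrable_abs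
            Bochner_Integration.integrable_diff add.hyps shift)?) linarith
    then show "(\<lambda>n. LINT x|lborel. \<bar>u x + v x - (u (x - w n) + v (x - w n))\<bar>) \<longlonglongrightarrow> 0"
      by (intro tendsto_sandwich[OF _ _ tendsto_const lim]) auto
  qed
next
  case (lim u s)
  \<comment> \<open>The induction principle supplies
    \<open>\<bar>s i x\<bar> \<le> 2 * \<bar>u x\<bar>\<close>, whence the majorant with factor 3
    for the difference.\<close>
  have "(\<lambda>i. LINT x|lborel. \<bar>u x - s i x\<bar>) \<longlonglongrightarrow> (LINT x::'a|lborel. 0)"
  proof (rule integral_dominated_convergence[where w = "\<lambda>x. 3 * \<bar>u x\<bar>"])
    show "AE x in lborel. (\<lambda>i. \<bar>u x - s i x\<bar>) \<longlonglongrightarrow> 0"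
    proof (rule AE_I2)
      fix x
      have "(\<lambda>i. s i x) \<longlonglongrightarrow> u x" using lim by simp
      then have "(\<lambda>i. \<bar>u x - s i x\<bar>) \<longlonglongrightarrow> \<bar>u x - u x\<bar>"
        by (intro tendsto_rabs tendsto_diff tendsto_const)
      then show "(\<lambda>i. \<bar>u x - s i x\<bar>) \<longlonglongrightarrow> 0" by simp
    qed
    show "AE x in lborel. norm \<bar>u x - s i x\<bar> \<le> 3 * \<bar>u x\<bar>" for i
    proof (rule AE_I2)
      fix x have "\<bar>s i x\<bar> \<le> 2 * \<bar>u x\<bar>" using lim.hyps(3)[of x i] by simp
      then show "norm \<bar>u x - s i x\<bar> \<le> 3 * \<bar>u x\<bar>" by simp
    qed
  qed (use lim in \<open>auto dest: borel_measurable_integrable\<close>)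
  then have conv: "(\<lambda>i. LINT x|lborel. \<bar>u x - s i x\<bar>) \<longlonglongrightarrow> 0" by simp
  show ?case
  proof (rule L1_shift_continuous_closed)
    fix e :: real assume "e > 0"
    then have "\<forall>\<^sub>F i in sequentially. (LINT x|lborel. \<bar>u x - s i x\<bar>) < e"
      by (rule order_tendstoD(2)[OF conv])
    then obtain i where "(LINT x|lborel. \<bar>u x - s i x\<bar>) < e"
      by (auto simp: eventually_sequentially)
    then show "\<exists>v. integrable lborel v \<and> L1_shift_continuous v \<and> (LINT x|lborel. \<bar>u x - v x\<bar>) < e"
      using lim by blast
  qed (use lim in auto)
qed

section \<open>Characters and the self-dual Gaussian\<close>

definition phase :: "real \<Rightarrow> complex" where
  "phase s = exp (2 * complex_of_real pi * \<i> * complex_of_real s)"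

lemma phase_add: "phase (s + r) = phase s * phase r"
  by (simp add: phase_def distrib_left exp_add)

lemma phase_diff: "phase (s - r) = phase s * phase (- r)"
  by (simp flip: phase_add)

lemma norm_phase [simp]: "norm (phase s) = 1"
  by (simp add: phase_def norm_exp_eq_Re)

lemma phase_0 [simp]: "phase 0 = 1"
  by (simp add: phase_def)

lemma cnj_phase: "cnj (phase s) = phase (- s)"
  by (simp add: phase_def exp_cnj)

lemma phase_sum: "phase (sum f A) = (\<Prod>i\<in>A. phase (f i))"
  by (induction A rule: infinite_finite_induct) (auto simp: phase_add)

lemma measurable_phase [measurable]: "phase \<in> borel_measurable borel"
  unfolding phase_def by measurable

text \<open>One polymorphic constant serves both the line and the whole space, so the factorization
  over coordinates relates two instances of it.\<close>

definition gauss :: "'a::real_normed_vector \<Rightarrow> real" where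
  "gauss x = exp (- (pi * (norm x)\<^sup>2))"

lemma gauss_0 [simp]: "gauss 0 = 1" and gauss_pos: "gauss x > 0" and gauss_le_1: "gauss x \<le> 1"
  by (simp_all add: gauss_def)

lemma measurable_gauss [measurable]:
  "(gauss :: 'a::euclidean_space \<Rightarrow> real) \<in> borel_measurable borel"
  unfolding gauss_def by measurable

text \<open>The substitution y = c x with c = sqrt(2 pi) turns the standard normal density into
  \<open>gauss x / c\<close>. The transform is then the normal characteristic function exp(-r^2/2)
  at r = c s.\<close>

lemma gauss_fourier_real:
  "integrable lborel (gauss :: real \<Rightarrow> real)"
  "(LINT x|lborel. gauss x * phase (s * x)) = complex_of_real (gauss s)"
proof -
  let ?c = "sqrt (2 * pi)"
  have c: "?c > 0" "?c \<noteq> 0" by simp_all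
  have sq: "?c\<^sup>2 = 2 * pi" by simp
  have dens: "std_normal_density (?c * x) = gauss x / ?c" for x
    using c by (simp add: normal_density_def gauss_def power_mult_distrib sq)
  have "integrable lborel (\<lambda>x. std_normal_density (0 + ?c * x))"
    by (rule lborel_integrable_real_affine) (use c in auto)
  then show "integrable lborel (gauss :: real \<Rightarrow> real)"
    using c integrable_mult_right[of ?c lborel "\<lambda>x. std_normal_density (?c * x)"] by (simp add: dens)
  have "char std_normal_distribution (?c * s) = (LINT x|lborel. std_normal_density x *\<^sub>R iexp (?c * s * x))"
    unfolding char_def by (subst integral_density) auto
  also have "\<dots> = \<bar>?c\<bar> *\<^sub>R (LINT x|lborel. std_normal_density (0 + ?c * x) *\<^sub>R iexp (?c * s * (0 + ?c * x)))"
    by (rule lborel_integral_real_affine) (use c in auto)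
  also have "\<dots> = (LINT x|lborel. gauss x * phase (s * x))"
  proof -
    have "\<bar>?c\<bar> *\<^sub>R (std_normal_density (0 + ?c * x) *\<^sub>R iexp (?c * s * (0 + ?c * x)))
        = gauss x * phase (s * x)" for x
    proof -
      have "?c * s * (0 + ?c * x) = 2 * pi * (s * x)"
        using sq by (simp add: power2_eq_square)
      then have "iexp (?c * s * (0 + ?c * x)) = phase (s * x)"
        by (simp only: phase_def) (simp add: mult_ac)
      then show ?thesis using c(2) dens[of x] by (simp add: scaleR_conv_of_real)
    qed
    then show ?thesis by (simp only: scaleR_conv_of_real flip: integral_mult_right_zero)
  qed
  finally show "(LINT x|lborel. gauss x * phase (s * x)) = complex_of_real (gauss s)"
    by (simp add: char_std_normal_distribution gauss_def power_mult_distrib sq)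
qed

text \<open>Lebesgue measure is the image of the product of one-dimensional measures under the map
  \<open>?T\<close> that assembles a vector from its coordinates. This reduces the Gaussian
  transform to dimension one.\<close>

lemma integral_lborel_prod:
  fixes f :: "'a::euclidean_space \<Rightarrow> real \<Rightarrow> complex"
  assumes "\<And>b. b \<in> Basis \<Longrightarrow> integrable lborel (f b)"
  shows "integrable lborel (\<lambda>x. \<Prod>b\<in>Basis. f b (x \<bullet> b))"
    and "(LINT x|lborel. (\<Prod>b\<in>Basis. f b (x \<bullet> b))) = (\<Prod>b\<in>Basis. (LINT x|lborel. f b x))"
proof -
  interpret product_sigma_finite "\<lambda>_::'a. lborel :: real measure" ..
  have [measurable]: "f b \<in> borel_measurable borel" if "b \<in> Basis" for b
    using assms[OF that] by auto
  let ?T = "\<lambda>y::'a \<Rightarrow> real. \<Sum>b\<in>Basis. y b *\<^sub>R b"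
  have T: "?T \<in> measurable (Pi\<^sub>M Basis (\<lambda>_. lborel)) borel" by measurable
  have comp: "(\<Prod>b\<in>Basis. f b (?T y \<bullet> b)) = (\<Prod>b\<in>Basis. f b (y b))" for y
    by (intro prod.cong) simp_all
  have meas: "(\<lambda>x. \<Prod>b\<in>Basis. f b (x \<bullet> b)) \<in> borel_measurable (borel :: 'a measure)"
    by (intro borel_measurable_prod) measurable
  show "integrable lborel (\<lambda>x. \<Prod>b\<in>Basis. f b (x \<bullet> b))"
    by (subst lborel_eq, subst integrable_distr_eq[OF T meas], simp only: comp)
       (rule product_integrable_prod; simp add: assms)
  show "(LINT x|lborel. (\<Prod>b\<in>Basis. f b (x \<bullet> b))) = (\<Prod>b\<in>Basis. (LINT x|lborel. f b x))"
    by (subst lborel_eq, subst integral_distr[OF T meas], simp only: comp)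
       (rule product_integral_prod; simp add: assms)
qed

text \<open>Both the Gaussian and the character turn the sum over coordinates in their exponents
  into a product, so the one-dimensional transform applies factor by factor.\<close>

lemma gauss_fourier:
  fixes v :: "'a::euclidean_space"
  shows "integrable lborel (gauss :: 'a \<Rightarrow> real)"
    and "(LINT x|lborel. gauss x * phase (v \<bullet> x)) = complex_of_real (gauss v)"
proof -
  have prod: "gauss x = (\<Prod>b\<in>Basis. gauss (x \<bullet> b))" for x :: 'a
    by (simp add: gauss_def norm_eq_sqrt_inner[of x] euclidean_inner[of x x] sum_nonneg
        sum_distrib_left exp_sum power2_eq_square flip: sum_negf)
  have fac: "gauss x * phase (v \<bullet> x) = (\<Prod>b\<in>Basis. gauss (x \<bullet> b) * phase ((v \<bullet> b) * (x \<bullet> b)))"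
    for x v :: 'a
    by (simp add: prod.distrib phase_sum[symmetric] euclidean_inner[of v x] prod[of x])
  have int: "integrable lborel (\<lambda>x. gauss x * phase (s * x))" for s :: real
    by (rule Bochner_Integration.integrable_bound[OF gauss_fourier_real(1)])
       (auto simp: norm_mult)
  show "(LINT x|lborel. gauss x * phase (v \<bullet> x)) = complex_of_real (gauss v)"
    unfolding fac
    by (subst integral_lborel_prod(2)[where f = "\<lambda>b y. gauss y * phase ((v \<bullet> b) * y)"])
       (simp_all add: int gauss_fourier_real(2) prod[of v])
  \<comment> \<open>Frequency 0 makes every phase factor 1.\<close>
  have "integrable lborel (\<lambda>x::'a. complex_of_real (gauss x))"
    using integral_lborel_prod(1)[where f = "\<lambda>b::'a. \<lambda>y. gauss y * phase ((0 \<bullet> b) * y)"] int[of 0]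
    unfolding fac[symmetric] by simp
  then show "integrable lborel (gauss :: 'a \<Rightarrow> real)"
    by (simp add: complex_of_real_integrable_eq)
qed

lemma integral_gauss: "(LINT x::'a::euclidean_space|lborel. gauss x) = 1"
proof -
  have "complex_of_real (LINT x::'a|lborel. gauss x) = 1"
    using gauss_fourier(2)[of "0::'a"] by (simp flip: integral_of_real)
  then show ?thesis by simp
qed

lemma measurable_cnj [measurable (raw)]:
  "f \<in> borel_measurable M \<Longrightarrow> (\<lambda>x. cnj (f x)) \<in> borel_measurable M"
  by (rule borel_measurable_continuous_on[OF continuous_on_cnj[OF continuous_on_id]])

lemma integral_lborel_reflect:
  fixes f :: "'a::euclidean_space \<Rightarrow> 'b::{banach, second_countable_topology}"
  assumes [measurable]: "f \<in> borel_measurable borel"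
  shows "(LINT x|lborel. f (w - x)) = (LINT x|lborel. f x)"
proof -
  have "(lborel :: 'a measure) = density (distr lborel borel (\<lambda>x. w + (- 1) *\<^sub>R x)) (\<lambda>_. 1)"
    using lborel_affine[of "- 1" w] by simp
  also have "\<dots> = distr lborel borel (\<lambda>x. w - x)"
    by (simp add: density_1)
  finally have eq: "(lborel :: 'a measure) = distr lborel borel (\<lambda>x. w - x)" .
  show ?thesis
    by (subst (2) eq) (simp add: integral_distr)
qed

text \<open>As a function of \<open>v\<close> the transform is an approximate identity: it has mass
  1 and concentrates at the origin as \<open>t\<close> tends to 0.\<close>

lemma gauss_fourier_scaled:
  fixes v :: "'a::euclidean_space"
  assumes t: "t > 0"
  shows "integrable lborel (\<lambda>u::'a. gauss (t *\<^sub>R u))"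
    and "(LINT u|lborel. gauss (t *\<^sub>R u) * phase (v \<bullet> u))
      = complex_of_real (gauss ((1 / t) *\<^sub>R v) / t ^ DIM('a))"
proof -
  show "integrable lborel (\<lambda>u::'a. gauss (t *\<^sub>R u))"
    using t gauss_fourier(1) by (subst integral_lborel_scale(2)) auto
  let ?f = "\<lambda>u. gauss u * phase (((1 / t) *\<^sub>R v) \<bullet> u)"
  have "(LINT u|lborel. ?f u) = t ^ DIM('a) *\<^sub>R (LINT u|lborel. ?f (t *\<^sub>R u))"
    by (rule integral_lborel_scale) (use t in auto)
  then show "(LINT u|lborel. gauss (t *\<^sub>R u) * phase (v \<bullet> u))
      = complex_of_real (gauss ((1 / t) *\<^sub>R v) / t ^ DIM('a))"
    using t unfolding gauss_fourier(2) by (simp add: scaleR_conv_of_real field_simps)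
qed

section \<open>Plancherel inequality\<close>

text \<open>A majorant that is a product of integrable functions of separate variables is integrable
  on the product space, which gives Fubini at once.\<close>

lemma integral_swap_product_bound:
  fixes F :: "'a::euclidean_space \<Rightarrow> 'b::euclidean_space \<Rightarrow> complex"
  assumes [measurable]: "case_prod F \<in> borel_measurable (lborel \<Otimes>\<^sub>M lborel)"
    and a: "integrable lborel a" and b: "integrable lborel b"
    and bound: "\<And>x y. norm (F x y) \<le> a x * b y"
  shows "(LINT x|lborel. LINT y|lborel. F x y) = (LINT y|lborel. LINT x|lborel. F x y)"
proof -
  have [measurable]: "a \<in> borel_measurable borel" "b \<in> borel_measurable borel"
    using a b by (auto dest: borel_measurable_integrable)
  have "integrable (lborel \<Otimes>\<^sub>M lborel) (\<lambda>(x, y). a x * b y)"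
  proof (rule lborel_pair.Fubini_integrable)
    show "integrable lborel (\<lambda>x. LINT y|lborel. norm (case (x, y) of (x, y) \<Rightarrow> a x * b y))"
      using a b by (simp add: abs_mult)
  qed (use b in auto)
  then have "integrable (lborel \<Otimes>\<^sub>M lborel) (case_prod F)"
    by (rule Bochner_Integration.integrable_bound) (auto intro!: AE_I2 order_trans[OF bound abs_ge_self])
  then show ?thesis
    by (rule lborel_pair.Fubini_integral[symmetric])
qed

text \<open>The product sigma-algebra of \<open>lebesgue\<close> does not make \<open>(x, z) \<mapsto> h (x - z)\<close> measurable for merely
  Lebesgue measurable \<open>h\<close>, so Fubini is applied to Borel functions over \<open>lborel\<close>.\<close>

definition fourier_borel :: "('a::euclidean_space \<Rightarrow> complex) \<Rightarrow> 'a \<Rightarrow> complex" where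
  "fourier_borel h u = (LINT x|lborel. h x * phase (x \<bullet> u))"

definition autocorr :: "('a::euclidean_space \<Rightarrow> complex) \<Rightarrow> 'a \<Rightarrow> complex" where
  "autocorr h w = (LINT x|lborel. h x * cnj (h (x - w)))"

lemma measurable_fourier_borel [measurable]:
  assumes [measurable]: "h \<in> borel_measurable borel"
  shows "fourier_borel h \<in> borel_measurable borel"
  unfolding fourier_borel_def by measurable

lemma norm_fourier_borel_le: "norm (fourier_borel h u) \<le> (LINT x|lborel. norm (h x))"
  unfolding fourier_borel_def
  by (rule order_trans[OF integral_norm_bound]) (simp add: norm_mult)

lemma norm_mult_le_squares: "norm (z * cnj w) \<le> (norm z)\<^sup>2 + (norm w)\<^sup>2" for z w :: complex
proof -
  have "2 * (norm z * norm w) \<le> (norm z)\<^sup>2 + (norm w)\<^sup>2"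
    using sum_squares_bound[of "norm z" "norm w"] by simp
  moreover have "0 \<le> (norm z)\<^sup>2 + (norm w)\<^sup>2" by simp
  ultimately show ?thesis unfolding norm_mult complex_mod_cnj by linarith
qed

text \<open>\<open>L1\<close> makes the Fourier integral converge at every point, and
  \<open>L2\<close> makes the autocorrelation integral converge at every shift.\<close>

locale borel_L1_L2 =
  fixes h :: "'a::euclidean_space \<Rightarrow> complex"
  assumes measurable_h [measurable]: "h \<in> borel_measurable borel"
    and L1: "integrable lborel h"
    and L2: "integrable lborel (\<lambda>x. (norm (h x))\<^sup>2)"
begin

lemma L2_shift: "integrable lborel (\<lambda>x. (norm (h (x - w)))\<^sup>2)"
  "(LINT x|lborel. (norm (h (x - w)))\<^sup>2) = (LINT x|lborel. (norm (h x))\<^sup>2)"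
  using L2 integral_lborel_translate[of "\<lambda>x. (norm (h x))\<^sup>2" w] by auto

lemma integrable_autocorr: "integrable lborel (\<lambda>x. h x * cnj (h (x - w)))"
  by (rule Bochner_Integration.integrable_bound[OF Bochner_Integration.integrable_add[OF L2 L2_shift(1)[of w]]])
     (auto intro: order_trans[OF norm_mult_le_squares])

text \<open>Fourier inversion for the conjugate of \<open>h\<close>, smoothed by the Gaussian
  approximate identity. Because of the smoothing it holds at every \<open>x\<close> and not only
  almost everywhere.\<close>

lemma damped_inversion:
  assumes t: "t > 0"
  shows "(LINT u|lborel. gauss (t *\<^sub>R u) * cnj (fourier_borel h u) * phase (x \<bullet> u))
    = (LINT z|lborel. gauss z * cnj (h (x - t *\<^sub>R z)))"
proof -
  have cnj_eq: "cnj (fourier_borel h u) = (LINT y|lborel. cnj (h y) * phase (- (y \<bullet> u)))" for u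
    unfolding fourier_borel_def by (subst Bochner_Integration.integral_cnj[symmetric]) (simp add: cnj_phase)
  have "(LINT u|lborel. gauss (t *\<^sub>R u) * cnj (fourier_borel h u) * phase (x \<bullet> u))
      = (LINT u|lborel. LINT y|lborel. gauss (t *\<^sub>R u) * cnj (h y) * phase ((x - y) \<bullet> u))"
    unfolding cnj_eq
    by (simp add: phase_diff inner_diff_left mult_ac
        flip: integral_mult_right_zero integral_mult_left_zero)
  \<comment> \<open>The damping factor is what makes the majorant integrable in \<open>u\<close>;
    the remaining factors are bounded by \<open>norm (h y)\<close> alone.\<close>
  also have "\<dots> = (LINT y|lborel. LINT u|lborel. gauss (t *\<^sub>R u) * cnj (h y) * phase ((x - y) \<bullet> u))"
    by (rule integral_swap_product_bound
        [where a = "\<lambda>u::'a. gauss (t *\<^sub>R u)" and b = "\<lambda>y. norm (h y)"])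
       (use gauss_fourier_scaled(1)[OF t] L1 in
         \<open>simp_all add: norm_mult gauss_pos[THEN less_imp_le]\<close>)
  also have "\<dots> = (LINT y|lborel. cnj (h y) * complex_of_real (gauss ((1 / t) *\<^sub>R (x - y)) / t ^ DIM('a)))"
  proof -
    have "(LINT u|lborel. gauss (t *\<^sub>R u) * cnj (h y) * phase ((x - y) \<bullet> u))
        = cnj (h y) * (LINT u|lborel. gauss (t *\<^sub>R u) * phase ((x - y) \<bullet> u))" for y
      by (simp add: mult_ac flip: integral_mult_right_zero)
    then show ?thesis by (simp only: gauss_fourier_scaled(2)[OF t])
  qed
  \<comment> \<open>Reflection about \<open>x\<close>, followed by the scaling y = t z, whose
    Jacobian cancels the power of \<open>t\<close> in the denominator.\<close>
  also have "\<dots> = (LINT y|lborel. cnj (h (x - y)) * complex_of_real (gauss ((1 / t) *\<^sub>R y) / t ^ DIM('a)))"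
    by (subst integral_lborel_reflect[of _ x, symmetric]) simp_all
  also have "\<dots> = t ^ DIM('a) *\<^sub>R
      (LINT z|lborel. cnj (h (x - t *\<^sub>R z)) * complex_of_real (gauss ((1 / t) *\<^sub>R t *\<^sub>R z) / t ^ DIM('a)))"
    by (rule integral_lborel_scale) (use t in auto)
  also have "\<dots> = (LINT z|lborel. gauss z * cnj (h (x - t *\<^sub>R z)))"
    using t by (simp add: scaleR_conv_of_real mult_ac)
  finally show ?thesis .
qed

text \<open>The squared modulus is the transform times its conjugate. Expanding the transform and
  swapping integrals leaves the damped inversion of the conjugate, and a second swap produces the
  autocorrelation.\<close>

lemma gauss_regularized:
  assumes t: "t > 0"
  shows "complex_of_real (LINT u|lborel. gauss (t *\<^sub>R u) * (norm (fourier_borel h u))\<^sup>2)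
    = (LINT z|lborel. gauss z * autocorr h (t *\<^sub>R z))"
proof -
  let ?H = "fourier_borel h"
  let ?C = "LINT x|lborel. norm (h x)"
  have "complex_of_real (LINT u|lborel. gauss (t *\<^sub>R u) * (norm (?H u))\<^sup>2)
      = (LINT u|lborel. gauss (t *\<^sub>R u) * cnj (?H u) * ?H u)"
    by (subst integral_complex_of_real[symmetric])
       (simp only: of_real_mult complex_norm_square mult_ac)
  also have "\<dots> = (LINT u|lborel. LINT x|lborel. gauss (t *\<^sub>R u) * cnj (?H u) * (h x * phase (x \<bullet> u)))"
    by (simp add: fourier_borel_def[of h] flip: integral_mult_right_zero)
  \<comment> \<open>The transform is bounded by the L1 norm \<open>?C\<close>, so a majorant in
    product form exists.\<close>
  also have "\<dots> = (LINT x|lborel. LINT u|lborel. gauss (t *\<^sub>R u) * cnj (?H u) * (h x * phase (x \<bullet> u)))"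
  proof -
    have "norm (gauss (t *\<^sub>R u) * cnj (?H u) * (h x * phase (x \<bullet> u)))
        \<le> (gauss (t *\<^sub>R u) * ?C) * norm (h x)" for u x
      using norm_fourier_borel_le[of h u] gauss_pos[of "t *\<^sub>R u"]
      by (simp add: norm_mult mult_right_mono less_imp_le)
    then show ?thesis
      using gauss_fourier_scaled(1)[OF t] L1
      by (intro integral_swap_product_bound
          [where a = "\<lambda>u::'a. gauss (t *\<^sub>R u) * ?C" and b = "\<lambda>x. norm (h x)"])
        (measurable, auto)
  qed
  also have "\<dots> = (LINT x|lborel. h x * (LINT z|lborel. gauss z * cnj (h (x - t *\<^sub>R z))))"
    by (simp add: damped_inversion[OF t, symmetric] mult_ac flip: integral_mult_right_zero)
  also have "\<dots> = (LINT x|lborel. LINT z|lborel. gauss z * (h x * cnj (h (x - t *\<^sub>R z))))"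
    by (simp add: mult_ac flip: integral_mult_right_zero)
  \<comment> \<open>The shift by \<open>t *\<^sub>R z\<close> couples the variables, so the product
    majorant is replaced by a bound \<open>2 * ?N\<close> on the inner integral that is uniform in
    the shift.\<close>
  also have "\<dots> = (LINT z|lborel. LINT x|lborel. gauss z * (h x * cnj (h (x - t *\<^sub>R z))))"
  proof -
    let ?F = "\<lambda>(z, x). complex_of_real (gauss z) * (h x * cnj (h (x - t *\<^sub>R z)))"
    let ?N = "LINT x|lborel. (norm (h x))\<^sup>2"
    have "integrable (lborel \<Otimes>\<^sub>M lborel) ?F"
    proof (rule lborel_pair.Fubini_integrable)
      show "integrable lborel (\<lambda>z. LINT x|lborel. norm (?F (z, x)))"
      proof (rule Bochner_Integration.integrable_bound)
        show "integrable lborel (\<lambda>z::'a. gauss z * (2 * ?N))"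
          using gauss_fourier(1)[where 'a = 'a] by simp
        have "(LINT x|lborel. norm (h x * cnj (h (x - w)))) \<le> 2 * ?N" for w
        proof -
          have "(LINT x|lborel. norm (h x * cnj (h (x - w))))
              \<le> (LINT x|lborel. (norm (h x))\<^sup>2 + (norm (h (x - w)))\<^sup>2)"
            by (intro integral_mono integrable_norm integrable_autocorr
                Bochner_Integration.integrable_add L2 L2_shift norm_mult_le_squares)
          then show ?thesis using L2 by (simp add: L2_shift)
        qed
        then show "AE z in lborel. norm (LINT x|lborel. norm (?F (z, x))) \<le> norm (gauss z * (2 * ?N))"
          by (intro AE_I2)
             (simp add: norm_mult[of "complex_of_real _"] gauss_pos[THEN less_imp_le] abs_mult mult_left_mono)
      qed measurable
      show "AE z in lborel. integrable lborel (\<lambda>x. ?F (z, x))"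
        using integrable_autocorr by (intro AE_I2) simp
    qed measurable
    from lborel_pair.Fubini_integral[OF this] show ?thesis .
  qed
  also have "\<dots> = (LINT z|lborel. gauss z * autocorr h (t *\<^sub>R z))"
    by (simp add: autocorr_def)
  finally show ?thesis .
qed

section \<open>Continuity of the autocorrelation at the origin and the limit of vanishing
  damping\<close>

definition sqdiff :: "'a \<Rightarrow> real" where
  "sqdiff w = (LINT x|lborel. (norm (h x - h (x - w)))\<^sup>2)"

lemma measurable_sqdiff [measurable]: "sqdiff \<in> borel_measurable borel"
  unfolding sqdiff_def by measurable

lemma norm_diff_square: "(norm (z - w))\<^sup>2 = (norm z)\<^sup>2 + (norm w)\<^sup>2 - 2 * Re (z * cnj w)" for z w :: complex
  unfolding cmod_power2 by (simp add: power2_eq_square algebra_simps)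

text \<open>Polarization: expand the square and use that translation preserves the L2 norm. The real
  part is enough because the damped integral of the squared transform is real.\<close>

lemma Re_autocorr: "Re (autocorr h w) = (LINT x|lborel. (norm (h x))\<^sup>2) - sqdiff w / 2"
proof -
  define R where "R x = Re (h x * cnj (h (x - w)))" for x
  have R: "integrable lborel R" "(LINT x|lborel. R x) = Re (autocorr h w)"
    unfolding R_def autocorr_def using integrable_autocorr by (rule integrable_Re, rule integral_Re)
  have "sqdiff w = (LINT x|lborel. (norm (h x))\<^sup>2 + (norm (h (x - w)))\<^sup>2 - 2 * R x)"
    by (simp only: sqdiff_def norm_diff_square R_def)
  also have "\<dots> = 2 * (LINT x|lborel. (norm (h x))\<^sup>2) - 2 * Re (autocorr h w)"
    using L2 L2_shift R by simp
  finally show ?thesis by (simp add: field_simps)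
qed

text \<open>The crude constant 2 suffices: the bound only serves to dominate integrands uniformly in
  the shift.\<close>

lemma norm_autocorr_le: "norm (autocorr h w) \<le> 2 * (LINT x|lborel. (norm (h x))\<^sup>2)"
proof -
  have "norm (autocorr h w) \<le> (LINT x|lborel. norm (h x * cnj (h (x - w))))"
    unfolding autocorr_def by (rule integral_norm_bound)
  also have "\<dots> \<le> (LINT x|lborel. (norm (h x))\<^sup>2 + (norm (h (x - w)))\<^sup>2)"
    by (intro integral_mono integrable_norm integrable_autocorr
        Bochner_Integration.integrable_add L2 L2_shift norm_mult_le_squares)
  finally show ?thesis using L2 by (simp add: L2_shift)
qed

lemma sqdiff_tendsto_0:
  assumes w: "w \<longlonglongrightarrow> 0"
  shows "(\<lambda>n. sqdiff (w n)) \<longlonglongrightarrow> 0"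
proof -
  txt \<open>The signed square \<open>a |a|\<close> reduces \<open>L\<^sup>2\<close> continuity of translations to \<open>L\<^sup>1\<close> continuity.\<close>
  define sq :: "real \<Rightarrow> real" where "sq a = a * \<bar>a\<bar>" for a
  \<comment> \<open>For equal signs the difference of signed squares factors as (a - b) times a sum
    of size \<bar>a\<bar> + \<bar>b\<bar> \<ge> \<bar>a - b\<bar>. For opposite signs it has size
    a^2 + b^2, which is at least half of (a - b)^2; this case forces the factor 2.\<close>
  have sq_diff: "(a - b)\<^sup>2 \<le> 2 * \<bar>sq a - sq b\<bar>" for a b
  proof -
    have eq: "(a - b)\<^sup>2 = \<bar>a - b\<bar> * \<bar>a - b\<bar>" by (simp add: power2_eq_square)
    consider "a \<ge> 0" "b \<ge> 0" | "a < 0" "b < 0" | "a \<ge> 0" "b < 0" | "a < 0" "b \<ge> 0" by linarith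
    then show ?thesis
    proof cases
      case 1
      then have "sq a - sq b = (a - b) * (a + b)"
        by (simp add: sq_def algebra_simps)
      then have "\<bar>sq a - sq b\<bar> = \<bar>a - b\<bar> * (a + b)"
        using 1 by (simp add: abs_mult)
      moreover have "\<bar>a - b\<bar> * \<bar>a - b\<bar> \<le> \<bar>a - b\<bar> * (a + b)"
        using 1 by (intro mult_left_mono) auto
      ultimately show ?thesis using eq by simp
    next
      case 2
      then have "sq a - sq b = (a - b) * (- a - b)"
        by (simp add: sq_def algebra_simps)
      then have "\<bar>sq a - sq b\<bar> = \<bar>a - b\<bar> * (- a - b)"
        using 2 by (simp add: abs_mult)
      moreover have "\<bar>a - b\<bar> * \<bar>a - b\<bar> \<le> \<bar>a - b\<bar> * (- a - b)"
        using 2 by (intro mult_left_mono) auto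
      ultimately show ?thesis using eq by simp
    next
      case 3
      then have "\<bar>sq a - sq b\<bar> = a\<^sup>2 + b\<^sup>2"
        by (simp add: sq_def power2_eq_square)
      then show ?thesis using zero_le_power2[of "a + b"] by (simp add: power2_eq_square algebra_simps)
    next
      case 4
      then have "\<bar>sq a - sq b\<bar> = a\<^sup>2 + b\<^sup>2"
        by (simp add: sq_def power2_eq_square)
      then show ?thesis using zero_le_power2[of "a + b"] by (simp add: power2_eq_square algebra_simps)
    qed
  qed
  have [measurable]: "sq \<in> borel_measurable borel" unfolding sq_def by measurable
  have sq_int: "integrable lborel (\<lambda>x. sq (\<phi> (h x)))" if "\<And>z. \<bar>\<phi> z\<bar> \<le> norm z" "\<phi> \<in> borel_measurable borel" for \<phi> :: "complex \<Rightarrow> real"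
  proof (rule Bochner_Integration.integrable_bound[OF L2])
    have [measurable]: "\<phi> \<in> borel_measurable borel" by fact
    show "(\<lambda>x. sq (\<phi> (h x))) \<in> borel_measurable lborel" by simp
    have "\<bar>\<phi> z\<bar> * \<bar>\<phi> z\<bar> \<le> norm z * norm z" for z
      using that(1) by (intro mult_mono) auto
    then show "AE x in lborel. norm (sq (\<phi> (h x))) \<le> norm ((norm (h x))\<^sup>2)"
      by (intro AE_I2) (simp add: sq_def abs_mult power2_eq_square)
  qed
  let ?r = "\<lambda>x. sq (Re (h x))" and ?i = "\<lambda>x. sq (Im (h x))"
  have r: "integrable lborel ?r" and i: "integrable lborel ?i"
    by (rule sq_int; simp add: abs_Re_le_cmod abs_Im_le_cmod)+
  have r_shift: "integrable lborel (\<lambda>x. ?r (x - y))" and i_shift: "integrable lborel (\<lambda>x. ?i (x - y))" for y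
    using r i integral_lborel_translate(2)[of ?r y] integral_lborel_translate(2)[of ?i y] by simp_all
  have bound: "sqdiff y \<le> 2 * (LINT x|lborel. \<bar>?r x - ?r (x - y)\<bar>) + 2 * (LINT x|lborel. \<bar>?i x - ?i (x - y)\<bar>)" for y
  proof -
    have "(norm (z - w))\<^sup>2 \<le> 2 * \<bar>sq (Re z) - sq (Re w)\<bar> + 2 * \<bar>sq (Im z) - sq (Im w)\<bar>" for z w
      using add_mono[OF sq_diff[of "Re z" "Re w"] sq_diff[of "Im z" "Im w"]] by (simp add: cmod_power2)
    then have "sqdiff y \<le> (LINT x|lborel. 2 * \<bar>?r x - ?r (x - y)\<bar> + 2 * \<bar>?i x - ?i (x - y)\<bar>)"
      unfolding sqdiff_def using r i r_shift[of y] i_shift[of y]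
      by (intro integral_mono') auto
    then show ?thesis
      using r i r_shift[of y] i_shift[of y] by simp
  qed
  have "L1_shift_continuous ?r" "L1_shift_continuous ?i"
    using r i by (auto intro: L1_shift_continuous_integrable)
  then have lim: "(\<lambda>n. 2 * (LINT x|lborel. \<bar>?r x - ?r (x - w n)\<bar>) + 2 * (LINT x|lborel. \<bar>?i x - ?i (x - w n)\<bar>)) \<longlonglongrightarrow> 0"
    using w unfolding L1_shift_continuous_def
    by (intro tendsto_add_zero tendsto_mult_right_zero) blast+
  have "sqdiff y \<ge> 0" for y
    by (simp add: sqdiff_def)
  then show ?thesis
    by (intro tendsto_sandwich[OF _ _ tendsto_const lim] always_eventually allI bound)
qed

text \<open>The damped integrals stay below the undamped one and converge to the left side.
  \<open>H\<close> justifies this comparison and keeps the right side from being the default value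
  0.\<close>

lemma plancherel_le:
  assumes H: "integrable lborel (\<lambda>u. (norm (fourier_borel h u))\<^sup>2)"
  shows "(LINT x|lborel. (norm (h x))\<^sup>2) \<le> (LINT u|lborel. (norm (fourier_borel h u))\<^sup>2)"
proof -
  let ?N = "LINT x|lborel. (norm (h x))\<^sup>2"
  define t where "t n = inverse (real (Suc n))" for n
  have t: "t n > 0" for n by (simp add: t_def)
  have t0: "t \<longlonglongrightarrow> 0" unfolding t_def by (rule LIMSEQ_inverse_real_of_nat)
  have [measurable]: "autocorr h \<in> borel_measurable borel"
    unfolding autocorr_def by measurable
  have "(\<lambda>n. LINT z|lborel. gauss z * Re (autocorr h (t n *\<^sub>R z))) \<longlonglongrightarrow> (LINT z::'a|lborel. gauss z * ?N)"
  proof (rule integral_dominated_convergence[where w = "\<lambda>z. gauss z * (2 * ?N)"])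
    show "AE z in lborel. (\<lambda>n. gauss z * Re (autocorr h (t n *\<^sub>R z))) \<longlonglongrightarrow> gauss z * ?N"
    proof (rule AE_I2)
      fix z :: 'a
      have "(\<lambda>n. t n *\<^sub>R z) \<longlonglongrightarrow> 0" using tendsto_scaleR[OF t0 tendsto_const[of z]] by simp
      from sqdiff_tendsto_0[OF this]
      have "(\<lambda>n. ?N - sqdiff (t n *\<^sub>R z) / 2) \<longlonglongrightarrow> ?N - 0 / 2"
        by (intro tendsto_intros) auto
      then show "(\<lambda>n. gauss z * Re (autocorr h (t n *\<^sub>R z))) \<longlonglongrightarrow> gauss z * ?N"
        unfolding Re_autocorr by (intro tendsto_intros) simp
    qed
    show "AE z in lborel. norm (gauss z * Re (autocorr h (t n *\<^sub>R z))) \<le> gauss z * (2 * ?N)" for n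
      using order_trans[OF abs_Re_le_cmod norm_autocorr_le]
      by (intro AE_I2) (simp add: abs_mult gauss_pos less_imp_le)
  qed (use gauss_fourier(1)[where 'a = 'a] in auto)
  moreover have "(LINT z|lborel. gauss z * Re (autocorr h (t n *\<^sub>R z)))
      \<le> (LINT u|lborel. (norm (fourier_borel h u))\<^sup>2)" for n
  proof -
    \<comment> \<open>Integrability is what allows the real part to be taken outside the
      integral.\<close>
    have int: "integrable lborel (\<lambda>z. gauss z * autocorr h (t n *\<^sub>R z))"
    proof (rule Bochner_Integration.integrable_bound)
      show "integrable lborel (\<lambda>z::'a. gauss z * (2 * ?N))"
        using gauss_fourier(1)[where 'a = 'a] by simp
      show "AE z in lborel. norm (gauss z * autocorr h (t n *\<^sub>R z)) \<le> norm (gauss z * (2 * ?N))"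
        using norm_autocorr_le
        by (intro AE_I2) (simp add: norm_mult abs_mult gauss_pos[THEN less_imp_le] mult_left_mono)
    qed measurable
    have "(LINT z|lborel. gauss z * Re (autocorr h (t n *\<^sub>R z)))
        = Re (LINT z|lborel. gauss z * autocorr h (t n *\<^sub>R z))"
      using integral_Re[OF int] by simp
    also have "\<dots> = (LINT u|lborel. gauss (t n *\<^sub>R u) * (norm (fourier_borel h u))\<^sup>2)"
      by (simp flip: gauss_regularized[OF t])
    also have "\<dots> \<le> (LINT u|lborel. (norm (fourier_borel h u))\<^sup>2)"
      using H by (intro integral_mono') (auto simp: mult_left_le_one_le gauss_le_1 gauss_pos less_imp_le)
    finally show ?thesis .
  qed
  ultimately have "(LINT z::'a|lborel. gauss z * ?N) \<le> (LINT u|lborel. (norm (fourier_borel h u))\<^sup>2)"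
    by (intro LIMSEQ_le_const2) auto
  then show ?thesis by (simp add: integral_gauss)
qed

end

section \<open>From Borel to Lebesgue measurable functions\<close>

lemma borel_version_complex:
  fixes h :: "'a::euclidean_space \<Rightarrow> complex"
  assumes h: "h \<in> borel_measurable lebesgue"
  obtains h' where "h' \<in> borel_measurable borel" "AE x in lebesgue. h x = h' x"
proof -
  have "(\<lambda>x. Re (h x)) \<in> borel_measurable lebesgue" "(\<lambda>x. Im (h x)) \<in> borel_measurable lebesgue"
    using h by measurable
  from this[THEN completion_ex_borel_measurable_real] obtain r i
    where [measurable]: "r \<in> borel_measurable borel" "i \<in> borel_measurable borel"
      and "AE x in lborel. Re (h x) = r x" "AE x in lborel. Im (h x) = i x"
    by auto
  then have "AE x in lebesgue. Re (h x) = r x" "AE x in lebesgue. Im (h x) = i x"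
    by (auto intro: AE_completion)
  then have "AE x in lebesgue. h x = Complex (r x) (i x)"
    by eventually_elim (simp add: complex_eq_iff)
  moreover have "(\<lambda>x. Complex (r x) (i x)) \<in> borel_measurable borel"
    by (simp add: borel_measurable_complex_iff)
  ultimately show ?thesis using that by blast
qed

lemma L2_norm_on_UNIV: "L2_norm_on UNIV f = sqrt (LINT x|lebesgue. (norm (f x))\<^sup>2)"
  by (simp add: L2_norm_on_def set_lebesgue_integral_def)

lemma L2_norm_le_fourier_integral:
  fixes h :: "'a::euclidean_space \<Rightarrow> complex"
  assumes h: "integrable lebesgue h" "square_integrable h"
    and H: "square_integrable (fourier_integral h)"
  shows "L2_norm_on UNIV h \<le> L2_norm_on UNIV (fourier_integral h)"
proof -
  have [measurable]: "h \<in> borel_measurable lebesgue"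
    using h by (auto dest: borel_measurable_integrable)
  obtain h' where h'[measurable]: "h' \<in> borel_measurable borel" and eq: "AE x in lebesgue. h x = h' x"
    by (rule borel_version_complex[of h]) auto
  have h'_leb [measurable]: "h' \<in> borel_measurable lebesgue"
    by (rule measurable_completion) simp
  have phase_leb [measurable]: "(\<lambda>x. phase (x \<bullet> u)) \<in> borel_measurable lebesgue" for u :: 'a
    by (rule measurable_completion) simp
  have norm_eq: "AE x in lebesgue. (norm (h x))\<^sup>2 = (norm (h' x))\<^sup>2"
    using eq by eventually_elim simp
  interpret borel_L1_L2 h'
  proof
    show "integrable lborel h'"
      using h(1) integrable_cong_AE[OF _ _ eq] by (simp add: integrable_completion)
    have "integrable lebesgue (\<lambda>x. (norm (h' x))\<^sup>2)"
      using h(2) integrable_cong_AE[OF _ _ norm_eq] by (simp add: square_integrable_def)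
    then show "integrable lborel (\<lambda>x. (norm (h' x))\<^sup>2)"
      by (simp add: integrable_completion)
  qed simp
  \<comment> \<open>The transforms agree at every frequency, because altering \<open>h\<close> on a
    null set changes none of the integrals.\<close>
  have fourier_eq: "fourier_integral h = fourier_borel h'"
  proof
    fix u
    have "fourier_integral h u = (LINT x|lebesgue. h x * phase (x \<bullet> u))"
      by (simp add: fourier_integral_def phase_def)
    also have "\<dots> = (LINT x|lebesgue. h' x * phase (x \<bullet> u))"
      by (rule integral_cong_AE) (use eq in auto)
    also have "\<dots> = fourier_borel h' u"
      unfolding fourier_borel_def by (rule integral_completion) simp
    finally show "fourier_integral h u = fourier_borel h' u" .
  qed
  have "(LINT x|lebesgue. (norm (h x))\<^sup>2) = (LINT x|lebesgue. (norm (h' x))\<^sup>2)"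
    by (rule integral_cong_AE[OF _ _ norm_eq]) simp_all
  also have "\<dots> = (LINT x|lborel. (norm (h' x))\<^sup>2)"
    by (rule integral_completion) simp
  also have "\<dots> \<le> (LINT u|lborel. (norm (fourier_borel h' u))\<^sup>2)"
    using H by (intro plancherel_le) (simp add: fourier_eq square_integrable_def integrable_completion)
  also have "\<dots> = (LINT u|lebesgue. (norm (fourier_integral h u))\<^sup>2)"
    unfolding fourier_eq by (rule integral_completion[symmetric]) simp
  finally show ?thesis
    by (simp add: L2_norm_on_UNIV)
qed

section \<open>\<open>L\<^sup>2\<close> norms\<close>

text \<open>Weighted triangle inequality. The weight 1 yields closure of L2 under sums, and the
  weight b / a, a ratio of norms, yields the Minkowski inequality.\<close>

lemma norm_add_square_le:
  fixes x y :: "'b::real_normed_vector"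
  assumes s: "s > 0"
  shows "(norm (x + y))\<^sup>2 \<le> (1 + s) * (norm x)\<^sup>2 + (1 + 1 / s) * (norm y)\<^sup>2"
proof -
  have "(norm (x + y))\<^sup>2 \<le> (norm x + norm y)\<^sup>2"
    by (intro power_mono norm_triangle_ineq) simp
  also have "\<dots> \<le> (1 + s) * (norm x)\<^sup>2 + (1 + 1 / s) * (norm y)\<^sup>2"
  proof -
    \<comment> \<open>This square bounds the cross term 2 \<bar>x\<bar> \<bar>y\<bar> by s
      \<bar>x\<bar>^2 + \<bar>y\<bar>^2 / s.\<close>
    have "0 \<le> (s * norm x - norm y)\<^sup>2 / s" using s by simp
    also have "\<dots> = s * (norm x)\<^sup>2 - 2 * (norm x * norm y) + (norm y)\<^sup>2 / s"
      using s by (simp add: power2_eq_square field_simps)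
    finally show ?thesis by (simp add: power2_sum algebra_simps)
  qed
  finally show ?thesis .
qed

lemma square_integrable_add:
  fixes f g :: "'a::euclidean_space \<Rightarrow> 'b::{real_normed_vector, second_countable_topology}"
  assumes "square_integrable f" "square_integrable g"
  shows "square_integrable (\<lambda>x. f x + g x)"
proof -
  have [measurable]: "f \<in> borel_measurable lebesgue" "g \<in> borel_measurable lebesgue"
    using assms by (auto simp: square_integrable_def)
  have "integrable lebesgue (\<lambda>x. 2 * (norm (f x))\<^sup>2 + 2 * (norm (g x))\<^sup>2)"
    using assms by (simp add: square_integrable_def)
  then have "integrable lebesgue (\<lambda>x. (norm (f x + g x))\<^sup>2)"
    by (rule Bochner_Integration.integrable_bound)
       (use norm_add_square_le[of 1] in auto)
  then show ?thesis by (simp add: square_integrable_def)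
qed

lemma square_integrable_diff:
  fixes f g :: "'a::euclidean_space \<Rightarrow> 'b::{real_normed_vector, second_countable_topology}"
  assumes "square_integrable f" "square_integrable g"
  shows "square_integrable (\<lambda>x. f x - g x)"
proof -
  have "square_integrable (\<lambda>x. - g x)"
    using assms(2) by (simp add: square_integrable_def)
  from square_integrable_add[OF assms(1) this] show ?thesis by simp
qed

text \<open>With weight \<open>b / a\<close> the weighted bound collapses to
  \<open>(a + b)\<^sup>2\<close>. The argument needs no inner product on the codomain.\<close>

lemma L2_norm_add_le:
  fixes f g :: "'a::euclidean_space \<Rightarrow> 'b::{real_normed_vector, second_countable_topology}"
  assumes f: "square_integrable f" and g: "square_integrable g"
  shows "L2_norm_on UNIV (\<lambda>x. f x + g x) \<le> L2_norm_on UNIV f + L2_norm_on UNIV g"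
proof (rule field_le_epsilon)
  fix e :: real assume e: "e > 0"
  define A where "A = (LINT x|lebesgue. (norm (f x))\<^sup>2)"
  define B where "B = (LINT x|lebesgue. (norm (g x))\<^sup>2)"
  txt \<open>The perturbation by \<open>e / 2\<close> keeps the ratio \<open>b / a\<close> below well-defined and positive.\<close>
  define a where "a = sqrt A + e / 2"
  define b where "b = sqrt B + e / 2"
  have AB: "A \<ge> 0" "B \<ge> 0" by (simp_all add: A_def B_def)
  have pos: "a > 0" "b > 0" using AB e by (simp_all add: a_def b_def add_nonneg_pos)
  have "(sqrt A)\<^sup>2 \<le> a\<^sup>2" "(sqrt B)\<^sup>2 \<le> b\<^sup>2"
    by (rule power_mono; use AB e in \<open>simp add: a_def b_def\<close>)+
  then have le: "A \<le> a\<^sup>2" "B \<le> b\<^sup>2" using AB by simp_all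
  have "(LINT x|lebesgue. (norm (f x + g x))\<^sup>2)
      \<le> (LINT x|lebesgue. (1 + b / a) * (norm (f x))\<^sup>2 + (1 + 1 / (b / a)) * (norm (g x))\<^sup>2)"
    using f g square_integrable_add[OF f g] pos
    by (intro integral_mono norm_add_square_le) (auto simp: square_integrable_def)
  also have "\<dots> = (1 + b / a) * A + (1 + 1 / (b / a)) * B"
    using f g by (simp add: square_integrable_def A_def B_def)
  also have "\<dots> \<le> (1 + b / a) * a\<^sup>2 + (1 + 1 / (b / a)) * b\<^sup>2"
    using pos le by (intro add_mono mult_left_mono) auto
  also have "\<dots> = (a + b)\<^sup>2"
    using pos by (simp add: power2_eq_square field_simps)
  finally have "sqrt (LINT x|lebesgue. (norm (f x + g x))\<^sup>2) \<le> a + b"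
    using pos by (intro real_le_lsqrt) auto
  then show "L2_norm_on UNIV (\<lambda>x. f x + g x) \<le> L2_norm_on UNIV f + L2_norm_on UNIV g + e"
    by (simp add: L2_norm_on_UNIV a_def b_def A_def B_def)
qed

lemma L2_norm_minus_commute: "L2_norm_on S (\<lambda>x. f x - g x) = L2_norm_on S (\<lambda>x. g x - f x)"
  by (simp add: L2_norm_on_def norm_minus_commute)

lemma L2_norm_triangle_diff:
  fixes f g :: "'a::euclidean_space \<Rightarrow> 'b::{real_normed_vector, second_countable_topology}"
  assumes "square_integrable f" "square_integrable g"
  shows "L2_norm_on UNIV f \<le> L2_norm_on UNIV (\<lambda>x. f x - g x) + L2_norm_on UNIV g"
  using L2_norm_add_le[OF square_integrable_diff[OF assms] assms(2)] by simp

lemma L2_norm_diff_le: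
  fixes f g :: "'a::euclidean_space \<Rightarrow> 'b::{real_normed_vector, second_countable_topology}"
  assumes "square_integrable f" "square_integrable g"
  shows "L2_norm_on UNIV (\<lambda>x. f x - g x) \<le> L2_norm_on UNIV f + L2_norm_on UNIV g"
proof -
  have "square_integrable (\<lambda>x. - g x)"
    using assms(2) by (simp add: square_integrable_def)
  from L2_norm_add_le[OF assms(1) this] show ?thesis
    by (simp add: L2_norm_on_UNIV)
qed

lemma L2_norm_on_nonneg: "0 \<le> L2_norm_on S f"
  by (simp add: L2_norm_on_def set_lebesgue_integral_def)

section \<open>The Fourier operator on \<open>L\<^sup>2\<close>\<close>

lemma fourier_integral_diff:
  fixes f g :: "'a::euclidean_space \<Rightarrow> complex"
  assumes "integrable lebesgue f" "integrable lebesgue g"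
  shows "fourier_integral (\<lambda>x. f x - g x) u = fourier_integral f u - fourier_integral g u"
proof -
  have phase_leb [measurable]: "(\<lambda>x. phase (x \<bullet> u)) \<in> borel_measurable lebesgue"
    by (rule measurable_completion) simp
  have int: "integrable lebesgue (\<lambda>x. h x * phase (x \<bullet> u))"
    if h: "integrable lebesgue h" for h :: "'a \<Rightarrow> complex"
  proof (rule Bochner_Integration.integrable_bound[OF h])
    have [measurable]: "h \<in> borel_measurable lebesgue"
      using h by (rule borel_measurable_integrable)
    show "(\<lambda>x. h x * phase (x \<bullet> u)) \<in> borel_measurable lebesgue" by measurable
  qed (simp add: norm_mult)
  show ?thesis
    using int[OF assms(1)] int[OF assms(2)]
    by (simp add: fourier_integral_def phase_def left_diff_distrib)
qed

text \<open>The differences of the two approximating sequences approximate the difference, by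
  linearity of the Fourier integral.\<close>

lemma is_fourier_L2_diff:
  fixes f1 f2 g1 g2 :: "'a::euclidean_space \<Rightarrow> complex"
  assumes "is_fourier_L2 f1 g1" "is_fourier_L2 f2 g2"
  shows "is_fourier_L2 (\<lambda>x. f1 x - f2 x) (\<lambda>u. g1 u - g2 u)"
proof -
  obtain h1 :: "nat \<Rightarrow> 'a \<Rightarrow> complex" where h1: "\<And>k. integrable lebesgue (h1 k)" "\<And>k. square_integrable (h1 k)"
    "\<And>k. square_integrable (fourier_integral (h1 k))"
    and lim1: "(\<lambda>k. L2_norm_on UNIV (\<lambda>x. h1 k x - f1 x)) \<longlonglongrightarrow> 0"
      "(\<lambda>k. L2_norm_on UNIV (\<lambda>u. fourier_integral (h1 k) u - g1 u)) \<longlonglongrightarrow> 0"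
    and sq1: "square_integrable f1" "square_integrable g1"
    using assms(1) unfolding is_fourier_L2_def by blast
  obtain h2 :: "nat \<Rightarrow> 'a \<Rightarrow> complex" where h2: "\<And>k. integrable lebesgue (h2 k)" "\<And>k. square_integrable (h2 k)"
    "\<And>k. square_integrable (fourier_integral (h2 k))"
    and lim2: "(\<lambda>k. L2_norm_on UNIV (\<lambda>x. h2 k x - f2 x)) \<longlonglongrightarrow> 0"
      "(\<lambda>k. L2_norm_on UNIV (\<lambda>u. fourier_integral (h2 k) u - g2 u)) \<longlonglongrightarrow> 0"
    and sq2: "square_integrable f2" "square_integrable g2"
    using assms(2) unfolding is_fourier_L2_def by blast
  \<comment> \<open>Stated for arbitrary sequences, since it is applied both to the approximants and
    to their transforms.\<close>
  have diff_lim: "(\<lambda>k. L2_norm_on UNIV (\<lambda>x. (a k x - b k x) - (p x - q x))) \<longlonglongrightarrow> 0"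
    if a: "\<And>k. square_integrable (a k)" and b: "\<And>k. square_integrable (b k)"
      and pq: "square_integrable p" "square_integrable q"
      and lims: "(\<lambda>k. L2_norm_on UNIV (\<lambda>x. a k x - p x)) \<longlonglongrightarrow> 0"
        "(\<lambda>k. L2_norm_on UNIV (\<lambda>x. b k x - q x)) \<longlonglongrightarrow> 0"
    for a b :: "nat \<Rightarrow> 'a \<Rightarrow> complex" and p q
  proof (rule tendsto_sandwich[OF _ _ tendsto_const tendsto_add_zero[OF lims]])
    show "\<forall>\<^sub>F k in sequentially. 0 \<le> L2_norm_on UNIV (\<lambda>x. (a k x - b k x) - (p x - q x))"
      by (simp add: L2_norm_on_nonneg)
    have "(a k x - b k x) - (p x - q x) = (a k x - p x) - (b k x - q x)" for k x by simp
    then show "\<forall>\<^sub>F k in sequentially. L2_norm_on UNIV (\<lambda>x. (a k x - b k x) - (p x - q x))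
        \<le> L2_norm_on UNIV (\<lambda>x. a k x - p x) + L2_norm_on UNIV (\<lambda>x. b k x - q x)"
      by (simp only:) (intro always_eventually allI L2_norm_diff_le square_integrable_diff a b pq)
  qed
  have F: "fourier_integral (\<lambda>x. h1 k x - h2 k x)
      = (\<lambda>u. fourier_integral (h1 k) u - fourier_integral (h2 k) u)" for k
    using h1 h2 by (intro ext fourier_integral_diff)
  show ?thesis
    unfolding is_fourier_L2_def
    by (intro conjI exI[of _ "\<lambda>k x. h1 k x - h2 k x"] allI; (subst F)?)
       (intro square_integrable_diff Bochner_Integration.integrable_diff diff_lim h1 h2 sq1 sq2 lim1 lim2)+
qed

text \<open>The Plancherel inequality for each approximant \<open>h k\<close> is placed between two
  triangle inequalities whose error terms vanish in the limit.\<close>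

lemma is_fourier_L2_norm_le:
  fixes f g :: "'a::euclidean_space \<Rightarrow> complex"
  assumes "is_fourier_L2 f g"
  shows "L2_norm_on UNIV f \<le> L2_norm_on UNIV g"
proof -
  obtain h :: "nat \<Rightarrow> 'a \<Rightarrow> complex" where h: "\<And>k. integrable lebesgue (h k)" "\<And>k. square_integrable (h k)"
    "\<And>k. square_integrable (fourier_integral (h k))"
    and lim: "(\<lambda>k. L2_norm_on UNIV (\<lambda>x. h k x - f x)) \<longlonglongrightarrow> 0"
      "(\<lambda>k. L2_norm_on UNIV (\<lambda>u. fourier_integral (h k) u - g u)) \<longlonglongrightarrow> 0"
    and sq: "square_integrable f" "square_integrable g"
    using assms unfolding is_fourier_L2_def by blast
  have bound: "L2_norm_on UNIV f \<le> L2_norm_on UNIV (\<lambda>x. h k x - f x)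
      + (L2_norm_on UNIV (\<lambda>u. fourier_integral (h k) u - g u) + L2_norm_on UNIV g)" for k
    using L2_norm_triangle_diff[OF sq(1) h(2)[of k]] L2_norm_minus_commute[of UNIV f "h k"]
      L2_norm_le_fourier_integral[OF h(1,2,3)[of k]] L2_norm_triangle_diff[OF h(3)[of k] sq(2)]
    by linarith
  have "(\<lambda>k. L2_norm_on UNIV (\<lambda>x. h k x - f x)
      + (L2_norm_on UNIV (\<lambda>u. fourier_integral (h k) u - g u) + L2_norm_on UNIV g))
      \<longlonglongrightarrow> 0 + (0 + L2_norm_on UNIV g)"
    by (intro tendsto_add lim tendsto_const)
  from LIMSEQ_le_const[OF this] bound show ?thesis by auto
qed

section \<open>Splitting the norm along \<open>D\<close> and bounding the inner part by the
  supremum\<close>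

lemma L2_norm_split_le:
  fixes q :: "'a::euclidean_space \<Rightarrow> real"
  assumes q: "square_integrable q" and D: "D \<in> sets lebesgue"
  shows "L2_norm_on UNIV q \<le> L2_norm_on D q + L2_norm_on (- D) q"
proof -
  have "integrable lebesgue (\<lambda>x. (norm (q x))\<^sup>2)"
    using q by (simp add: square_integrable_def)
  then have int: "set_integrable lebesgue S (\<lambda>x. (norm (q x))\<^sup>2)" if "S \<in> sets lebesgue" for S
    using that unfolding set_integrable_def
    by (intro integrable_mult_indicator)
  have "(LINT x:D \<union> - D|lebesgue. (norm (q x))\<^sup>2)
      = (LINT x:D|lebesgue. (norm (q x))\<^sup>2) + (LINT x:- D|lebesgue. (norm (q x))\<^sup>2)"
    using D by (intro set_integral_Un int) (auto simp: Compl_in_sets_lebesgue)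
  then show ?thesis
    by (simp add: L2_norm_on_def Un_commute sqrt_add_le_add_sqrt set_lebesgue_integral_def)
qed

text \<open>If the supremum is a finite \<open>r\<close>, the integrand on \<open>D\<close> is at
  most the constant \<open>r\<^sup>2 / ?m\<close>, whose integral over \<open>D\<close> is
  \<open>r\<^sup>2\<close>. An infinite supremum makes the claim trivial.\<close>

lemma L2_norm_on_le_sup:
  fixes q :: "'a::euclidean_space \<Rightarrow> real"
  assumes D: "D \<in> lmeasurable" and q: "square_integrable q"
  shows "ennreal (L2_norm_on D q) \<le> (SUP u. ennreal (sqrt ((q u)\<^sup>2 * measure lebesgue D)))"
proof (cases "(SUP u. ennreal (sqrt ((q u)\<^sup>2 * measure lebesgue D)))")
  case (real r)
  let ?m = "measure lebesgue D"
  have bound: "(q u)\<^sup>2 * ?m \<le> r\<^sup>2" for u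
  proof -
    have "ennreal (sqrt ((q u)\<^sup>2 * ?m)) \<le> ennreal r"
      unfolding real(2)[symmetric] by (rule SUP_upper) simp
    then have "sqrt ((q u)\<^sup>2 * ?m) \<le> r" using real(1) by simp
    then show ?thesis by (rule sqrt_le_D)
  qed
  have "(LINT x:D|lebesgue. (norm (q x))\<^sup>2) \<le> r\<^sup>2"
  \<comment> \<open>For a null set the supremum says nothing about \<open>q\<close>, but the
    integral over \<open>D\<close> vanishes anyway.\<close>
  proof (cases "?m = 0")
    case True
    then have "D \<in> null_sets lebesgue"
      using D by (intro null_setsI) (simp_all add: emeasure_eq_measure2 fmeasurableD)
    then have "AE x in lebesgue. indicator D x *\<^sub>R (norm (q x))\<^sup>2 = (0::real)"
      by (auto dest: AE_not_in elim: eventually_mono)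
    then show ?thesis
      unfolding set_lebesgue_integral_def by (subst integral_eq_zero_AE) auto
  next
    case False
    then have m: "?m > 0" by (simp add: zero_less_measure_iff)
    have "(LINT x:D|lebesgue. (norm (q x))\<^sup>2) \<le> (LINT x:D|lebesgue. r\<^sup>2 / ?m)"
    proof (rule set_integral_mono)
      show "set_integrable lebesgue D (\<lambda>x. (norm (q x))\<^sup>2)"
        using q D unfolding set_integrable_def square_integrable_def
        by (intro integrable_mult_indicator) auto
      show "set_integrable lebesgue D (\<lambda>x. r\<^sup>2 / ?m)"
        using D by (auto simp: set_integrable_def fmeasurable_def)
    qed (use m bound in \<open>simp add: field_simps\<close>)
    also have "\<dots> = r\<^sup>2"
      using D m by (simp add: set_lebesgue_integral_def fmeasurable_def)
    finally show ?thesis .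
  qed
  then have "L2_norm_on D q \<le> r"
    using real(1) by (simp add: L2_norm_on_def real_le_lsqrt)
  then show ?thesis
    unfolding real(2) by (rule ennreal_leI)
next
  case top
  then show ?thesis by (simp only: top_greatest)
qed

text \<open>\<open>fbar\<close> is complex valued because the inverse transform of a real function
  need not be real. \<open>\<nu>\<close> lives in \<open>ennreal\<close> because a continuous L2
  function can be unbounded, so the supremum may be infinite.\<close>

theorem theorem2p1:
  fixes f g gt \<phi>1 P :: "'a::euclidean_space \<Rightarrow> real"
    and fbar :: "'a \<Rightarrow> complex"
    and D :: "'a set"
    and n :: nat and p :: "nat \<Rightarrow> 'a" and a :: "nat \<Rightarrow> real"
    and \<kappa> :: "'a \<times> real \<Rightarrow> 'a \<times> real \<Rightarrow> real"
    and c :: real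
    and \<nu> :: ennreal
  assumes D: "compact D"
    and nodes: "n \<ge> 1" "inj_on p {1..n}" "\<forall>i\<in>{1..n}. p i \<in> D"
    and scaling: "\<forall>u. u \<notin> D \<longrightarrow> gt u = 0"
    and kernel: "radial_kernel \<kappa>" "strictly_positive_definite \<kappa>"
    and coeffs: "\<forall>i\<in>{1..n}. (\<Sum>j=1..n. vsk_matrix \<kappa> gt p i j * a j) = g (p i)"
    and c: "c > 0"
    and phi1: "smooth_on \<phi>1 (- D)" "rapidly_decreasing \<phi>1"
    and phi: "continuous_on UNIV (cutoff D \<phi>1)"
    and P: "P = extend_interpolant D c \<phi>1 (vsk_interpolant \<kappa> gt n p a)"
    and cont: "continuous_on UNIV f" "continuous_on UNIV fbar"
              "continuous_on UNIV g" "continuous_on UNIV P"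
    and L2: "square_integrable f" "square_integrable fbar"
            "square_integrable g" "square_integrable P"
    and fourier_f: "is_fourier_L2 (\<lambda>x. complex_of_real (f x)) (\<lambda>u. complex_of_real (g u))"
    and fourier_fbar: "is_fourier_L2 fbar (\<lambda>u. complex_of_real (P u))"
    and nu: "\<nu> = (SUP u. ennreal (sqrt ((g u - P u)\<^sup>2 * measure lebesgue D)))"
  shows "ennreal (L2_norm_on UNIV (\<lambda>x. complex_of_real (f x) - fbar x))
           \<le> \<nu> + ennreal (L2_norm_on (- D) (\<lambda>u. g u - P u))"
proof -
  let ?q = "\<lambda>u. g u - P u"
  have q: "square_integrable ?q"
    using L2(3,4) by (rule square_integrable_diff)
  have Dm: "D \<in> lmeasurable"
    using D by (rule lmeasurable_compact)
  have "L2_norm_on UNIV (\<lambda>x. complex_of_real (f x) - fbar x)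
      \<le> L2_norm_on UNIV (\<lambda>u. complex_of_real (g u) - complex_of_real (P u))"
    by (intro is_fourier_L2_norm_le is_fourier_L2_diff fourier_f fourier_fbar)
  also have "\<dots> = L2_norm_on UNIV ?q"
    by (simp add: L2_norm_on_def flip: of_real_diff)
  also have "\<dots> \<le> L2_norm_on D ?q + L2_norm_on (- D) ?q"
    using q Dm by (intro L2_norm_split_le) auto
  \<comment> \<open>Nonnegativity of the two partial norms lets \<open>ennreal\<close> distribute
    over their sum.\<close>
  finally have "ennreal (L2_norm_on UNIV (\<lambda>x. complex_of_real (f x) - fbar x))
      \<le> ennreal (L2_norm_on D ?q) + ennreal (L2_norm_on (- D) ?q)"
    by (simp add: L2_norm_on_nonneg flip: ennreal_plus)
  also have "\<dots> \<le> \<nu> + ennreal (L2_norm_on (- D) ?q)"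
    unfolding nu by (intro add_right_mono L2_norm_on_le_sup Dm q)
  finally show ?thesis .
qed

end
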